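(* Consider an $L$-layer LISTA network with initial weights $(W_{10}^l)_{i,j}\sim\mathcal N(0,1)$, $(W_{20}^l)_{i,j}\sim\mathcal N(0,1)$ i.i.d., $l\in[L]$, and suppose $\|W_{20}^l\|\le c_{20}\sqrt m$ for all $l$ with $c_{20}=3$. Then for any $\mathbf W_1,\mathbf W_2$ with $\|\mathbf W_1-\mathbf W_{10}\|\le R_1$ and $\|\mathbf W_2-\mathbf W_{20}\|\le R_2$ and any $s\in[m]$, $$\|\mathbf b_s^l\|\le L_\sigma^{L-l}\big(c_{20}+R_2/\sqrt m\big)^{L-l},\quad l\in[L].$$ In particular, at initialization ($R_2=0$), $\|\mathbf b^l_{s,0}\|\le L_\sigma^{L-l}c_{20}^{L-l}$.
   Context: Fix $\lambda>0$ and $\sigma(x)=\log(1+e^{x-\lambda})-\log(1+e^{-x-\lambda})$ (componentwise), with $|\sigma'|\le L_\sigma$. LISTA: input $\mathbf y\in\mathbb R^n$, initial $\mathbf x^0\in\mathbb R^m$, $\mathbf x^l=\sigma\big(\frac1{\sqrt n}W_1^l\mathbf y+\frac1{\sqrt m}W_2^l\mathbf x^{l-1}\big)$ with $W_1^l\in\mathbb R^{m\times n}$, $W_2^l\in\mathbb R^{m\times m}$, output $\mathbf f=\frac1{\sqrt m}\mathbf x^L$, $f_s$ its $s$-th entry. $\mathbf b_s^l=\partial f_s/\partial\mathbf x^l\in\mathbb R^m$, and $\mathbf b^l_{s,0}$ is $\mathbf b_s^l$ evaluated at the initial weights. $\mathbf W_1=(W_1^l)_l$, $\mathbf W_2=(W_2^l)_l$;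 the distance $\|\mathbf W_1-\mathbf W_{10}\|$ is the Frobenius norm over all entries. $\|\cdot\|$ is the Euclidean norm for vectors and the spectral norm for matrices. *)

theory Defs
  imports "HOL-Analysis.Analysis"
begin

text \<open>Scalar activation sigma(x) = log(1+e^(x-lambda)) - log(1+e^(-x-lambda)).\<close>
definition sigma :: "real \<Rightarrow> real \<Rightarrow> real" where
  "sigma lam x = ln (1 + exp (x - lam)) - ln (1 + exp (- x - lam))"

text \<open>Componentwise activation.\<close>
definition sigma_vec :: "real \<Rightarrow> real ^ 'm \<Rightarrow> real ^ 'm" where
  "sigma_vec lam v = (\<chi> i. sigma lam (v $ i))"

text \<open>Layer l of LISTA: x \<mapsto> sigma(W1^l y / sqrt n + W2^l x / sqrt m).\<close>
definition lista_layer ::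
  "real \<Rightarrow> (nat \<Rightarrow> real ^ 'n ^ 'm) \<Rightarrow> (nat \<Rightarrow> real ^ 'm ^ 'm) \<Rightarrow> real ^ 'n
     \<Rightarrow> nat \<Rightarrow> real ^ 'm \<Rightarrow> real ^ 'm" where
  "lista_layer lam W1 W2 y l x =
     sigma_vec lam ((1 / sqrt (real CARD('n))) *\<^sub>R (W1 l *v y)
                  + (1 / sqrt (real CARD('m))) *\<^sub>R (W2 l *v x))"

text \<open>lista_run ... l k x: starting from x = x^l, apply layers l+1, ..., l+k.\<close>
primrec lista_run ::
  "real \<Rightarrow> (nat \<Rightarrow> real ^ 'n ^ 'm) \<Rightarrow> (nat \<Rightarrow> real ^ 'm ^ 'm) \<Rightarrow> real ^ 'n
     \<Rightarrow> nat \<Rightarrow> nat \<Rightarrow> real ^ 'm \<Rightarrow> real ^ 'm" where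
  "lista_run lam W1 W2 y l 0 x = x"
| "lista_run lam W1 W2 y l (Suc k) x = lista_run lam W1 W2 y (Suc l) k (lista_layer lam W1 W2 y (Suc l) x)"

text \<open>Hidden state x^l computed from the initial state x^0.\<close>
definition lista_state where
  "lista_state lam W1 W2 y x0 l = lista_run lam W1 W2 y 0 l x0"

text \<open>f_s as a function of the layer-l state x^l (network of depth L).\<close>
definition lista_out_from ::
  "real \<Rightarrow> (nat \<Rightarrow> real ^ 'n ^ 'm) \<Rightarrow> (nat \<Rightarrow> real ^ 'm ^ 'm) \<Rightarrow> real ^ 'n
     \<Rightarrow> nat \<Rightarrow> nat \<Rightarrow> 'm \<Rightarrow> real ^ 'm \<Rightarrow> real" where
  "lista_out_from lam W1 W2 y L l s x =
     (lista_run lam W1 W2 y l (L - l) x $ s) / sqrt (real CARD('m))"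

text \<open>b_s^l = partial f_s / partial x^l, evaluated at the actual state x^l
  (gradient, built from the Frechet derivative).\<close>
definition lista_b ::
  "real \<Rightarrow> (nat \<Rightarrow> real ^ 'n ^ 'm) \<Rightarrow> (nat \<Rightarrow> real ^ 'm ^ 'm) \<Rightarrow> real ^ 'n
     \<Rightarrow> real ^ 'm \<Rightarrow> nat \<Rightarrow> nat \<Rightarrow> 'm \<Rightarrow> real ^ 'm" where
  "lista_b lam W1 W2 y x0 L l s =
     (\<chi> i. frechet_derivative (lista_out_from lam W1 W2 y L l s)
              (at (lista_state lam W1 W2 y x0 l)) (axis i 1))"

text \<open>Frobenius distance over all layers 1..L.\<close>
definition weights_dist :: "nat \<Rightarrow> (nat \<Rightarrow> real ^ 'a::finite ^ 'b::finite) \<Rightarrow> (nat \<Rightarrow> real ^ 'a ^ 'b) \<Rightarrow> real" where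
  "weights_dist L W V = sqrt (\<Sum>l\<in>{1..L}. \<Sum>i\<in>UNIV. \<Sum>j\<in>UNIV. (W l $ i $ j - V l $ i $ j)\<^sup>2)"

text \<open>Spectral (operator) norm of a matrix.\<close>
definition spec_norm :: "real ^ 'a ^ 'b \<Rightarrow> real" where
  "spec_norm A = onorm (\<lambda>x. A *v x)"

end

theory Submission
  imports Defs
begin

text \<open>The map from the layer-l state to the output is the composition of the layers
  l+1, ..., L followed by the scaled coordinate projection v \<mapsto> v_s / sqrt m, so by the chain
  rule its derivative norm is at most the product of theirs.  Layer j is sigma applied
  componentwise after x \<mapsto> W2^j x / sqrt m plus a constant, hence its derivative norm is at most L_sigma ||W2^j|| / sqrt m, and
  ||W2^j|| \<le> ||W20^j|| + ||W2^j - W20^j||_F \<le> 3 sqrt m + R2.  The projection contributes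
  1 / sqrt m \<le> 1, and the gradient b_s^l has norm at most the derivative norm of the output.\<close>

definition has_bounded_derivative ::
  "('a::real_normed_vector \<Rightarrow> 'b::real_normed_vector) \<Rightarrow> 'a \<Rightarrow> real \<Rightarrow> bool" where
  "has_bounded_derivative f x c \<longleftrightarrow>
     (\<exists>D. (f has_derivative D) (at x) \<and> (\<forall>h. norm (D h) \<le> c * norm h))"

lemma has_bounded_derivativeI:
  assumes "(f has_derivative D) (at x)" and "\<And>h. norm (D h) \<le> c * norm h"
  shows "has_bounded_derivative f x c"
  using assms unfolding has_bounded_derivative_def by blast

lemma has_bounded_derivative_linear:
  assumes "bounded_linear f" and "\<And>h. norm (f h) \<le> c * norm h"
  shows "has_bounded_derivative f x c"
  using bounded_linear_imp_has_derivative[OF assms(1)] assms(2) by (rule has_bounded_derivativeI)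

lemma has_bounded_derivative_mono:
  assumes "has_bounded_derivative f x c" and "c \<le> d"
  shows "has_bounded_derivative f x d"
  using assms unfolding has_bounded_derivative_def
  by (meson mult_right_mono norm_ge_zero order_trans)

lemma has_bounded_derivative_compose:
  assumes f: "has_bounded_derivative f x c" and g: "has_bounded_derivative g (f x) d"
    and "0 \<le> d"
  shows "has_bounded_derivative (\<lambda>x. g (f x)) x (d * c)"
proof -
  obtain Df where Df: "(f has_derivative Df) (at x)" "\<And>h. norm (Df h) \<le> c * norm h"
    using f unfolding has_bounded_derivative_def by blast
  obtain Dg where Dg: "(g has_derivative Dg) (at (f x))" "\<And>h. norm (Dg h) \<le> d * norm h"
    using g unfolding has_bounded_derivative_def by blast
  show ?thesis
  proof (rule has_bounded_derivativeI)
    show "((\<lambda>x. g (f x)) has_derivative (\<lambda>h. Dg (Df h))) (at x)"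
      using has_derivative_compose[OF Df(1) Dg(1)] .
    fix h
    have "norm (Dg (Df h)) \<le> d * norm (Df h)" by (fact Dg(2))
    also have "\<dots> \<le> d * (c * norm h)" using Df(2) \<open>0 \<le> d\<close> by (rule mult_left_mono)
    finally show "norm (Dg (Df h)) \<le> d * c * norm h" by simp
  qed
qed

text \<open>The gradient b represents the derivative D, so ||b||^2 = D b \<le> c ||b||.\<close>
lemma norm_gradient_le:
  fixes f :: "real ^ 'm::finite \<Rightarrow> real"
  assumes "has_bounded_derivative f p c"
  shows "norm (\<chi> i. frechet_derivative f (at p) (axis i 1)) \<le> c"
proof -
  obtain D where D: "(f has_derivative D) (at p)" "\<And>h. norm (D h) \<le> c * norm h"
    using assms unfolding has_bounded_derivative_def by blast
  have lin: "linear D" using has_derivative_linear[OF D(1)] .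
  define b where "b = (\<chi> i. frechet_derivative f (at p) (axis i 1))"
  have b: "b = (\<chi> i. D (axis i 1))"
    unfolding b_def frechet_derivative_at[OF D(1), symmetric] ..
  have "0 \<le> c" using D(2)[of "axis undefined 1"] norm_ge_zero[of "D (axis undefined 1)"] by simp
  have "norm b ^ 2 = (\<Sum>i\<in>UNIV. b $ i * D (axis i 1))"
    by (simp add: power2_norm_eq_inner inner_vec_def b)
  also have "\<dots> = D (\<Sum>i\<in>UNIV. b $ i *\<^sub>R axis i 1)"
    by (simp add: linear_sum[OF lin] linear_scale[OF lin])
  also have "(\<Sum>i\<in>UNIV. b $ i *\<^sub>R axis i 1) = b"
    using basis_expansion[of b] by (simp add: scalar_mult_eq_scaleR)
  finally have "norm b * norm b \<le> c * norm b"
    using D(2)[of b] by (simp add: power2_eq_square)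
  then have "norm b \<le> c"
    using \<open>0 \<le> c\<close> by (metis mult_right_le_imp_le norm_ge_zero order.not_eq_order_implies_strict)
  then show ?thesis unfolding b_def .
qed

lemma sigma_has_real_derivative: "(sigma lam has_real_derivative deriv (sigma lam) x) (at x)"
proof -
  have "\<exists>D. (sigma lam has_real_derivative D) (at x)"
    unfolding sigma_def[abs_def]
    by (rule exI, (rule derivative_eq_intros refl | simp add: add_pos_pos)+)
  then show ?thesis using DERIV_imp_deriv by blast
qed

lemma sigma_vec_has_derivative:
  fixes z :: "real ^ 'm::finite"
  shows "(sigma_vec lam has_derivative (\<lambda>h. \<chi> i. deriv (sigma lam) (z $ i) * h $ i)) (at z)"
proof (subst has_derivative_componentwise_within, intro ballI)
  fix b :: "real ^ 'm" assume "b \<in> Basis"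
  then obtain i where b: "b = axis i 1" by (auto simp: Basis_vec_def)
  have "((\<lambda>x. x $ i) has_derivative (\<lambda>h. h $ i)) (at z)"
    by (rule bounded_linear_imp_has_derivative[OF bounded_linear_vec_nth])
  moreover have "(sigma lam has_derivative (\<lambda>h. deriv (sigma lam) (z $ i) * h)) (at (z $ i))"
    using sigma_has_real_derivative by (simp add: has_field_derivative_def)
  ultimately have "((\<lambda>x. sigma lam (x $ i)) has_derivative
      (\<lambda>h. deriv (sigma lam) (z $ i) * h $ i)) (at z)"
    by (rule has_derivative_compose)
  then show "((\<lambda>x. sigma_vec lam x \<bullet> b) has_derivative
      (\<lambda>x. (\<chi> i. deriv (sigma lam) (z $ i) * x $ i) \<bullet> b)) (at z)"
    by (simp add: b inner_axis sigma_vec_def mult.commute)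
qed

lemma norm_componentwise_mult_le:
  fixes d h :: "real ^ 'm::finite"
  assumes "\<And>i. \<bar>d $ i\<bar> \<le> c"
  shows "norm (\<chi> i. d $ i * h $ i) \<le> c * norm h"
proof -
  have "norm (\<chi> i. d $ i * h $ i) = L2_set (\<lambda>i. \<bar>d $ i * h $ i\<bar>) UNIV"
    by (simp add: norm_vec_def)
  also have "\<dots> \<le> L2_set (\<lambda>i. c * \<bar>h $ i\<bar>) UNIV"
    by (rule L2_set_mono) (auto simp: abs_mult intro!: mult_right_mono assms)
  also have "\<dots> = c * norm h"
    using assms[of undefined] by (simp add: L2_set_right_distrib norm_vec_def)
  finally show ?thesis .
qed

lemma sigma_vec_affine_has_bounded_derivative:
  fixes A :: "real ^ 'n::finite ^ 'm::finite"
  assumes "\<forall>x. \<bar>deriv (sigma lam) x\<bar> \<le> L\<^sub>\<sigma>"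
  shows "has_bounded_derivative (\<lambda>x. sigma_vec lam (c + A *v x)) x (L\<^sub>\<sigma> * onorm ((*v) A))"
proof (rule has_bounded_derivativeI)
  let ?z = "c + A *v x"
  have "((\<lambda>x. c + A *v x) has_derivative (*v) A) (at x)"
    by (auto intro!: derivative_eq_intros bounded_linear_imp_has_derivative)
  from has_derivative_compose[OF this sigma_vec_has_derivative]
  show "((\<lambda>x. sigma_vec lam (c + A *v x)) has_derivative
      (\<lambda>h. \<chi> i. deriv (sigma lam) (?z $ i) * (A *v h) $ i)) (at x)" .
  have "0 \<le> L\<^sub>\<sigma>" using assms order_trans[OF abs_ge_zero] by blast
  fix h
  have "norm (\<chi> i. deriv (sigma lam) (?z $ i) * (A *v h) $ i) \<le> L\<^sub>\<sigma> * norm (A *v h)"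
    using norm_componentwise_mult_le[of "\<chi> i. deriv (sigma lam) (?z $ i)"] assms by simp
  also have "\<dots> \<le> L\<^sub>\<sigma> * (onorm ((*v) A) * norm h)"
    using onorm[OF matrix_vector_mul_bounded_linear] \<open>0 \<le> L\<^sub>\<sigma>\<close> by (rule mult_left_mono)
  finally show "norm (\<chi> i. deriv (sigma lam) (?z $ i) * (A *v h) $ i)
      \<le> L\<^sub>\<sigma> * onorm ((*v) A) * norm h" by simp
qed

lemma lista_layer_has_bounded_derivative:
  fixes W1 :: "nat \<Rightarrow> real ^ 'n::finite ^ 'm::finite" and W2 :: "nat \<Rightarrow> real ^ 'm ^ 'm"
  assumes "\<forall>x. \<bar>deriv (sigma lam) x\<bar> \<le> L\<^sub>\<sigma>"
  shows "has_bounded_derivative (lista_layer lam W1 W2 y l) x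
           (L\<^sub>\<sigma> * onorm ((*v) (W2 l)) / sqrt (real CARD('m)))"
proof -
  define a where "a = 1 / sqrt (real CARD('m))"
  define c where "c = (1 / sqrt (real CARD('n))) *\<^sub>R (W1 l *v y)"
  have layer: "lista_layer lam W1 W2 y l = (\<lambda>x. sigma_vec lam (c + (a *\<^sub>R W2 l) *v x))"
    by (auto simp: lista_layer_def a_def c_def scaleR_matrix_vector_assoc)
  have "(*v) (a *\<^sub>R W2 l) = (\<lambda>x. a *\<^sub>R (W2 l *v x))"
    by (auto simp: scaleR_matrix_vector_assoc)
  then have "onorm ((*v) (a *\<^sub>R W2 l)) = a * onorm ((*v) (W2 l))"
    using onorm_scaleR[OF matrix_vector_mul_bounded_linear, of a "W2 l"] by (simp add: a_def)
  with sigma_vec_affine_has_bounded_derivative[OF assms, of c "a *\<^sub>R W2 l" x]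
  show ?thesis unfolding layer by (simp add: a_def)
qed

lemma lista_run_has_bounded_derivative:
  fixes W1 :: "nat \<Rightarrow> real ^ 'n::finite ^ 'm::finite" and W2 :: "nat \<Rightarrow> real ^ 'm ^ 'm"
  assumes "\<forall>x. \<bar>deriv (sigma lam) x\<bar> \<le> L\<^sub>\<sigma>" and "0 \<le> K"
    and "\<And>j. j \<in> {Suc l..l + k} \<Longrightarrow> L\<^sub>\<sigma> * onorm ((*v) (W2 j)) / sqrt (real CARD('m)) \<le> K"
  shows "has_bounded_derivative (lista_run lam W1 W2 y l k) x (K ^ k)"
  using assms(3)
proof (induction k arbitrary: l x)
  case 0
  show ?case by (simp add: has_bounded_derivative_linear bounded_linear_ident)
next
  case (Suc k)
  have layer: "has_bounded_derivative (lista_layer lam W1 W2 y (Suc l)) x K"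
    using lista_layer_has_bounded_derivative[OF assms(1), of W1 W2 y "Suc l" x] Suc.prems[of "Suc l"]
    by (auto intro: has_bounded_derivative_mono)
  have run: "has_bounded_derivative (lista_run lam W1 W2 y (Suc l) k)
      (lista_layer lam W1 W2 y (Suc l) x) (K ^ k)"
    using Suc.IH Suc.prems by simp
  have "0 \<le> K ^ k" using \<open>0 \<le> K\<close> by simp
  from has_bounded_derivative_compose[OF layer run this]
  show ?case by (simp add: mult.commute)
qed

lemma onorm_le_frobenius:
  fixes A :: "real ^ 'n::finite ^ 'm::finite"
  shows "onorm ((*v) A) \<le> sqrt (\<Sum>i\<in>UNIV. \<Sum>j\<in>UNIV. (A $ i $ j)\<^sup>2)"
proof (rule onorm_le)
  fix x :: "real ^ 'n"
  have "norm (A *v x) = L2_set (\<lambda>i. \<bar>A $ i \<bullet> x\<bar>) UNIV"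
    by (simp add: norm_vec_def matrix_vector_mult_def inner_vec_def)
  also have "\<dots> \<le> L2_set (\<lambda>i. norm x * norm (A $ i)) UNIV"
    by (rule L2_set_mono) (metis Cauchy_Schwarz_ineq2 mult.commute, simp)
  also have "\<dots> = norm x * L2_set (\<lambda>i. norm (A $ i)) UNIV"
    by (simp add: L2_set_right_distrib)
  also have "L2_set (\<lambda>i. norm (A $ i)) UNIV = sqrt (\<Sum>i\<in>UNIV. \<Sum>j\<in>UNIV. (A $ i $ j)\<^sup>2)"
    by (simp add: L2_set_def norm_vec_def sum_nonneg)
  finally show "norm (A *v x) \<le> sqrt (\<Sum>i\<in>UNIV. \<Sum>j\<in>UNIV. (A $ i $ j)\<^sup>2) * norm x"
    by (simp add: mult.commute)
qed

lemma onorm_le_add_weights_dist: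
  fixes W W0 :: "nat \<Rightarrow> real ^ 'n::finite ^ 'm::finite"
  assumes "j \<in> {1..L}"
  shows "onorm ((*v) (W j)) \<le> onorm ((*v) (W0 j)) + weights_dist L W W0"
proof -
  have "onorm ((*v) (W j)) = onorm (\<lambda>x. W0 j *v x + (W j - W0 j) *v x)"
    by (simp add: matrix_vector_mult_diff_rdistrib)
  also have "\<dots> \<le> onorm ((*v) (W0 j)) + onorm ((*v) (W j - W0 j))"
    by (rule onorm_triangle) auto
  also have "onorm ((*v) (W j - W0 j)) \<le> sqrt (\<Sum>i\<in>UNIV. \<Sum>k\<in>UNIV. (W j $ i $ k - W0 j $ i $ k)\<^sup>2)"
    using onorm_le_frobenius[of "W j - W0 j"] by simp
  also have "\<dots> \<le> weights_dist L W W0"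
    unfolding weights_dist_def
    by (rule real_sqrt_le_mono, rule member_le_sum[OF assms]) (auto intro!: sum_nonneg)
  finally show ?thesis by simp
qed

lemma weights_dist_nonneg: "0 \<le> weights_dist L W W0"
  unfolding weights_dist_def by (simp add: sum_nonneg)

lemma scaled_onorm_le_of_weights_dist:
  fixes W W0 :: "nat \<Rightarrow> real ^ 'm::finite ^ 'm"
  assumes "0 \<le> L\<^sub>\<sigma>" and "j \<in> {1..L}"
    and "spec_norm (W0 j) \<le> c * sqrt (real CARD('m))" and "weights_dist L W W0 \<le> R"
  shows "L\<^sub>\<sigma> * onorm ((*v) (W j)) / sqrt (real CARD('m))
           \<le> L\<^sub>\<sigma> * (c + R / sqrt (real CARD('m)))"
proof -
  define m where "m = sqrt (real CARD('m))"
  have "onorm ((*v) (W j)) \<le> onorm ((*v) (W0 j)) + weights_dist L W W0"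
    using assms(2) by (rule onorm_le_add_weights_dist)
  also have "\<dots> \<le> c * m + R"
    using assms(3,4) unfolding spec_norm_def m_def by (rule add_mono)
  finally have "onorm ((*v) (W j)) / m \<le> c + R / m"
    unfolding m_def by (simp add: divide_le_eq distrib_right)
  with \<open>0 \<le> L\<^sub>\<sigma>\<close> show ?thesis
    unfolding m_def by (simp add: mult_left_mono flip: times_divide_eq_right)
qed

lemma lista_out_from_has_bounded_derivative:
  fixes W1 :: "nat \<Rightarrow> real ^ 'n::finite ^ 'm::finite" and W2 :: "nat \<Rightarrow> real ^ 'm ^ 'm"
  assumes "has_bounded_derivative (lista_run lam W1 W2 y l (L - l)) x c"
  shows "has_bounded_derivative (lista_out_from lam W1 W2 y L l s) x (c / sqrt (real CARD('m)))"
proof -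
  define m where "m = sqrt (real CARD('m))"
  have "m > 0" unfolding m_def by simp
  have "has_bounded_derivative (\<lambda>v :: real ^ 'm. v $ s / m) (lista_run lam W1 W2 y l (L - l) x) (1 / m)"
  proof (rule has_bounded_derivative_linear)
    show "bounded_linear (\<lambda>v :: real ^ 'm. v $ s / m)"
      using bounded_linear_compose[OF bounded_linear_divide bounded_linear_vec_nth] .
    show "norm (h $ s / m) \<le> 1 / m * norm h" for h :: "real ^ 'm"
      using component_le_norm_cart[of h s] \<open>m > 0\<close> by (simp add: divide_right_mono)
  qed
  from has_bounded_derivative_compose[OF assms this] \<open>m > 0\<close>
  have "has_bounded_derivative (\<lambda>x. lista_run lam W1 W2 y l (L - l) x $ s / m) x (c / m)"
    by simp
  then show ?thesis unfolding m_def lista_out_from_def[abs_def] .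
qed

theorem lemma6:
  fixes lam L\<^sub>\<sigma> R1 R2 :: real
    and L :: nat
    and W10 W1 :: "nat \<Rightarrow> real ^ 'n::finite ^ 'm::finite"
    and W20 W2 :: "nat \<Rightarrow> real ^ 'm ^ 'm"
    and y :: "real ^ 'n" and x0 :: "real ^ 'm" and s :: 'm
  assumes "lam > 0"
    and "\<forall>x. \<bar>deriv (sigma lam) x\<bar> \<le> L\<^sub>\<sigma>"
    and "\<forall>l\<in>{1..L}. spec_norm (W20 l) \<le> 3 * sqrt (real CARD('m))"
    and "weights_dist L W1 W10 \<le> R1"
    and "weights_dist L W2 W20 \<le> R2"
    and "l \<in> {1..L}"
  shows "norm (lista_b lam W1 W2 y x0 L l s)
           \<le> L\<^sub>\<sigma> ^ (L - l) * (3 + R2 / sqrt (real CARD('m))) ^ (L - l)"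
proof -
  define m where "m = sqrt (real CARD('m))"
  define K where "K = L\<^sub>\<sigma> * (3 + R2 / m)"
  have "1 \<le> m" unfolding m_def by simp
  have "0 \<le> L\<^sub>\<sigma>" using assms(2) order_trans[OF abs_ge_zero] by blast
  have "0 \<le> R2" using assms(5) weights_dist_nonneg order_trans by blast
  have "0 \<le> K" unfolding K_def using \<open>0 \<le> L\<^sub>\<sigma>\<close> \<open>0 \<le> R2\<close> \<open>1 \<le> m\<close> by simp
  have "has_bounded_derivative (lista_run lam W1 W2 y l (L - l)) x (K ^ (L - l))" for x
  proof (rule lista_run_has_bounded_derivative[OF assms(2) \<open>0 \<le> K\<close>])
    fix j assume "j \<in> {Suc l..l + (L - l)}"
    then have "j \<in> {1..L}" using assms(6) by auto
    with \<open>0 \<le> L\<^sub>\<sigma>\<close> assms(3,5)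
    show "L\<^sub>\<sigma> * onorm ((*v) (W2 j)) / sqrt (real CARD('m)) \<le> K"
      unfolding K_def m_def by (intro scaled_onorm_le_of_weights_dist) auto
  qed
  then have "norm (lista_b lam W1 W2 y x0 L l s) \<le> K ^ (L - l) / m"
    unfolding lista_b_def m_def by (intro norm_gradient_le lista_out_from_has_bounded_derivative)
  also have "\<dots> \<le> K ^ (L - l)"
    using \<open>0 \<le> K\<close> \<open>1 \<le> m\<close> by (simp add: divide_le_eq mult_le_cancel_left1)
  finally show ?thesis by (simp add: K_def m_def power_mult_distrib)
qed

end
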